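(* Let $X$ be a second countable $T_0$ space. Then the well-filterification of $X$ coincides with the sobrification of $X$.
   Context: A space is second countable if its topology has a countable base. For a $T_0$ space $X$, the lower Vietoris topology on a family of closed sets has as subbasis the sets $\diamondsuit U=\{A: A\cap U\neq\emptyset\}$, $U$ open in $X$. The sobrification of $X$ is the set $\mathbf{IRR}(X)$ of (nonempty) irreducible closed subsets of $X$ with the lower Vietoris topology, with embedding $x\mapsto cl(\{x\})$. A set is saturated if it is an intersection of open sets. A space is well-filtered if for each filtered family $\mathcal C$ (nonempty, any two members contain a common member) of compact saturated sets and each open $U$ with $\bigcap\mathcal C\subseteq U$ there is $K\in\mathcal C$ with $K\subseteq U$. A subset $A$ of a $T_0$ space $X$ is a $WD$-set if for every continuous $f:X\to Y$ into a well-filtered ($T_0$) space $Y$ there is a unique $y_A\in Y$ with $cl(f(A))=cl(\{y_A\})$; $\mathbf{WD}(X)$ is the set of closed $WD$-sets. The well-filterification (well-filtered reflection) of $X$ is $\mathbf{WD}(X)$ with the lower Vietoris topology and the map $x\mapsto cl(\{x\})$; it is contained in $\mathbf{IRR}(X)$. "Coincides" means $\mathbf{WD}(X)=\mathbf{IRR}(X)$. *)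

theory Defs
  imports "HOL-Analysis.Analysis"
begin

definition saturated_in :: "'a topology \<Rightarrow> 'a set \<Rightarrow> bool" where
  "saturated_in X S \<longleftrightarrow>
     (\<exists>\<U>. (\<forall>U\<in>\<U>. openin X U) \<and> S = topspace X \<inter> \<Inter>\<U>)"

definition filtered_family :: "'a set set \<Rightarrow> bool" where
  "filtered_family \<C> \<longleftrightarrow>
     \<C> \<noteq> {} \<and> (\<forall>A\<in>\<C>. \<forall>B\<in>\<C>. \<exists>C\<in>\<C>. C \<subseteq> A \<and> C \<subseteq> B)"

definition well_filtered :: "'a topology \<Rightarrow> bool" where
  "well_filtered X \<longleftrightarrow>
     (\<forall>\<C> U. filtered_family \<C> \<and> (\<forall>K\<in>\<C>. compactin X K \<and> saturated_in X K) \<and>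
            openin X U \<and> \<Inter>\<C> \<subseteq> U \<longrightarrow> (\<exists>K\<in>\<C>. K \<subseteq> U))"

definition irreducible_in :: "'a topology \<Rightarrow> 'a set \<Rightarrow> bool" where
  "irreducible_in X A \<longleftrightarrow>
     A \<subseteq> topspace X \<and> A \<noteq> {} \<and>
     (\<forall>B C. closedin X B \<and> closedin X C \<and> A \<subseteq> B \<union> C \<longrightarrow> A \<subseteq> B \<or> A \<subseteq> C)"

definition IRR :: "'a topology \<Rightarrow> 'a set set" where
  "IRR X = {A. closedin X A \<and> irreducible_in X A}"

(* HOL cannot quantify over the carrier type of the test spaces Y inside a definition, so
   that type is an explicit parameter 'b.  The universal property of WD-sets is the intended
   one as soon as 'b is large enough to carry the well-filterification of X, whose points
   are closed subsets of X; it does not depend on the choice of such a 'b. *)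
definition WD_set :: "'b itself \<Rightarrow> 'a topology \<Rightarrow> 'a set \<Rightarrow> bool" where
  "WD_set _ X A \<longleftrightarrow>
     A \<subseteq> topspace X \<and>
     (\<forall>(Y :: 'b topology) f. t0_space Y \<and> well_filtered Y \<and> continuous_map X Y f \<longrightarrow>
        (\<exists>!y. y \<in> topspace Y \<and> Y closure_of (f ` A) = Y closure_of {y}))"

definition WD :: "'b itself \<Rightarrow> 'a topology \<Rightarrow> 'a set set" where
  "WD T X = {A. closedin X A \<and> WD_set T X A}"

(* A subbasis on the carrier \<F>: the empty intersection is \<F>, whereas
   topology_generated_by takes the union of its argument as carrier, so \<F> is inserted. *)
definition lower_vietoris :: "'a topology \<Rightarrow> 'a set set \<Rightarrow> 'a set topology" where
  "lower_vietoris X \<F> =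
     topology_generated_by (insert \<F> {{A \<in> \<F>. A \<inter> U \<noteq> {}} | U. openin X U})"

lemma topspace_lower_vietoris: "topspace (lower_vietoris X \<F>) = \<F>"
  unfolding lower_vietoris_def topology_generated_by_topspace by auto

definition point_closure :: "'a topology \<Rightarrow> 'a \<Rightarrow> 'a set" where
  "point_closure X x = X closure_of {x}"

(* Both completions are a space together with its canonical map from X. *)
definition sobrification :: "'a topology \<Rightarrow> 'a set topology \<times> ('a \<Rightarrow> 'a set)" where
  "sobrification X = (lower_vietoris X (IRR X), point_closure X)"

definition well_filterification ::
    "'b itself \<Rightarrow> 'a topology \<Rightarrow> 'a set topology \<times> ('a \<Rightarrow> 'a set)" where
  "well_filterification T X = (lower_vietoris X (WD T X), point_closure X)"

end

theory Submission
  imports Defs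
begin

text \<open>
  Since both completions carry the lower Vietoris topology and the same canonical map, everything
  comes down to \<open>WD X = IRR X\<close>.

  \<^item> A \<open>WD\<close>-set is irreducible. Finite spaces are well-filtered, so a \<open>WD\<close>-set may be tested against
    finite powers of the Sierpinski space. A finite family of open sets defines a map into such a
    power; if each member meets \<open>A\<close>, the point whose closure is the closure of the image of \<open>A\<close> has
    to be the top point. That point is isolated, hence attained on \<open>A\<close>, which says that the members
    and \<open>A\<close> have a point in common (\<open>WD_set_meets_finite_Inter\<close>). The hypothesis on the universe
    provides room for these finite spaces.

  \<^item> An irreducible set \<open>A\<close> in a second countable space is a \<open>WD\<close>-set. Only countably many basic open
    sets meet \<open>A\<close>, and irreducibility lets one choose points \<open>x n \<in> A\<close> in the first \<open>n + 1\<close> of them.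
    Then every open set that meets \<open>A\<close> contains almost all \<open>x n\<close>
    (\<open>irreducible_in_second_countable_sequence\<close>). Consequently each tail of \<open>x\<close> is compact: the member
    of a cover that contains one point of the tail misses only finitely many others. Under a
    continuous \<open>f\<close> into a well-filtered \<open>Y\<close>, the saturations of the images of the tails form a
    filtered family of compact saturated sets, each of which meets the closure of \<open>f ` A\<close>.
    Well-filteredness yields a point \<open>y\<close> of this closure in all of them. An open set that meets
    \<open>f ` A\<close> contains the image of a tail, hence its saturation, hence \<open>y\<close>; so \<open>y\<close> is the required
    generic point, unique by the \<open>T\<^sub>0\<close> axiom.
\<close>

section \<open>Finite powers of the Sierpinski space\<close>

lemma finite_imp_well_filtered:
  assumes "finite (topspace Y)"
  shows "well_filtered Y"
  unfolding well_filtered_def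
proof (intro allI impI, elim conjE)
  fix \<C> U
  assume filt: "filtered_family \<C>" and K: "\<forall>K\<in>\<C>. compactin Y K \<and> saturated_in Y K"
    and sub: "\<Inter>\<C> \<subseteq> U"
  have "\<C> \<subseteq> Pow (topspace Y)"
    using K compactin_subset_topspace by blast
  then have "finite \<C>"
    using assms finite_subset by blast
  moreover have "\<C> \<noteq> {}"
    using filt unfolding filtered_family_def by blast
  ultimately obtain K where K: "K \<in> \<C>" "\<And>L. L \<in> \<C> \<Longrightarrow> L \<subseteq> K \<Longrightarrow> L = K"
    using finite_has_minimal by metis
  have "K \<subseteq> L" if "L \<in> \<C>" for L
    using filt K that unfolding filtered_family_def by metis
  then show "\<exists>K\<in>\<C>. K \<subseteq> U"
    using K(1) sub by blast
qed

text \<open>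
  For finite \<open>S\<close> this is the \<open>S\<close>-fold power of the Sierpinski space: a point is coded by the set of
  coordinates at which it is the open point, and the open sets are the upper sets for inclusion. The injection
  \<open>e\<close> transports the space to a prescribed type.
\<close>

definition sierpinski_power :: "('s set \<Rightarrow> 'b) \<Rightarrow> 's set \<Rightarrow> 'b topology" where
  "sierpinski_power e S =
     topology (\<lambda>U. U \<subseteq> e ` Pow S \<and> (\<forall>P Q. e P \<in> U \<and> P \<subseteq> Q \<and> Q \<subseteq> S \<longrightarrow> e Q \<in> U))"

lemma openin_sierpinski_power:
  "openin (sierpinski_power e S) U \<longleftrightarrow>
     U \<subseteq> e ` Pow S \<and> (\<forall>P Q. e P \<in> U \<and> P \<subseteq> Q \<and> Q \<subseteq> S \<longrightarrow> e Q \<in> U)"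
proof -
  have "istopology (\<lambda>U. U \<subseteq> e ` Pow S \<and> (\<forall>P Q. e P \<in> U \<and> P \<subseteq> Q \<and> Q \<subseteq> S \<longrightarrow> e Q \<in> U))"
    unfolding istopology_def by blast
  then show ?thesis
    unfolding sierpinski_power_def by (simp add: topology_inverse')
qed

lemma openin_sierpinski_power_cone:
  assumes "inj e"
  shows "openin (sierpinski_power e S) (e ` {R. P \<subseteq> R \<and> R \<subseteq> S})"
  unfolding openin_sierpinski_power inj_image_mem_iff[OF assms] by blast

lemma topspace_sierpinski_power:
  assumes "inj e"
  shows "topspace (sierpinski_power e S) = e ` Pow S"
proof
  show "topspace (sierpinski_power e S) \<subseteq> e ` Pow S"
    using openin_topspace[of "sierpinski_power e S"] unfolding openin_sierpinski_power by blast
  have "openin (sierpinski_power e S) (e ` Pow S)"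
    using openin_sierpinski_power_cone[OF assms, of S "{}"] by (simp add: Pow_def)
  then show "e ` Pow S \<subseteq> topspace (sierpinski_power e S)"
    by (rule openin_subset)
qed

lemma t0_space_sierpinski_power:
  assumes "inj e"
  shows "t0_space (sierpinski_power e S)"
  unfolding t0_space_def topspace_sierpinski_power[OF assms]
proof (intro ballI impI)
  fix p q
  assume "p \<in> e ` Pow S" "q \<in> e ` Pow S" "p \<noteq> q"
  then obtain P Q where PQ: "p = e P" "q = e Q" "P \<subseteq> S" "Q \<subseteq> S" "P \<noteq> Q"
    by blast
  let ?cone = "\<lambda>P. e ` {R. P \<subseteq> R \<and> R \<subseteq> S}"
  have mem: "e R \<in> ?cone P' \<longleftrightarrow> P' \<subseteq> R \<and> R \<subseteq> S" for R P'
    using assms by (auto simp: inj_image_mem_iff)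
  have "\<exists>P'. (e P \<notin> ?cone P') = (e Q \<in> ?cone P')"
    unfolding mem using PQ by blast
  then show "\<exists>U. openin (sierpinski_power e S) U \<and> (p \<notin> U \<longleftrightarrow> q \<in> U)"
    unfolding PQ using openin_sierpinski_power_cone[OF assms] by blast
qed

text \<open>
  The sets \<open>W s\<close> around \<open>z\<close> cut out a neighbourhood of \<open>z\<close>, open because \<open>S\<close> is finite. Its points
  are mapped above the image of \<open>z\<close>, hence into every upper set that contains this image.
\<close>

lemma continuous_map_into_sierpinski_power:
  assumes e: "inj e" and fin: "finite S" and W: "\<And>s. s \<in> S \<Longrightarrow> openin X (W s)"
  shows "continuous_map X (sierpinski_power e S) (\<lambda>z. e {s \<in> S. z \<in> W s})"
  unfolding continuous_map_def topspace_sierpinski_power[OF e]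
proof (intro conjI allI impI)
  show "(\<lambda>z. e {s \<in> S. z \<in> W s}) \<in> topspace X \<rightarrow> e ` Pow S"
    by blast
  fix U
  assume U: "openin (sierpinski_power e S) U"
  let ?V = "{z \<in> topspace X. e {s \<in> S. z \<in> W s} \<in> U}"
  have "\<exists>T. openin X T \<and> z \<in> T \<and> T \<subseteq> ?V" if z: "z \<in> ?V" for z
  proof -
    let ?T = "topspace X \<inter> \<Inter> (W ` {s \<in> S. z \<in> W s})"
    have "openin X ?T"
      using fin W by (intro openin_Int_Inter) auto
    moreover have "z' \<in> ?V" if z': "z' \<in> ?T" for z'
    proof -
      have "{s \<in> S. z \<in> W s} \<subseteq> {s \<in> S. z' \<in> W s}"
        using z' by blast
      then show ?thesis
        using U z z' unfolding openin_sierpinski_power by blast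
    qed
    ultimately show ?thesis
      using z by blast
  qed
  then show "openin X ?V"
    by (subst openin_subopen) blast
qed

section \<open>WD-sets are irreducible\<close>

text \<open>
  The empty family is included and says that a \<open>WD\<close>-set is nonempty.
\<close>

lemma WD_set_meets_finite_Inter:
  fixes X :: "'a topology" and W :: "'s \<Rightarrow> 'a set"
  assumes e: "inj (e :: 's set \<Rightarrow> 'b)" and WD: "WD_set TYPE('b) X A"
    and fin: "finite S" and W: "\<And>s. s \<in> S \<Longrightarrow> openin X (W s)"
    and meets: "\<And>s. s \<in> S \<Longrightarrow> A \<inter> W s \<noteq> {}"
  shows "\<exists>a\<in>A. \<forall>s\<in>S. a \<in> W s"
proof -
  let ?Y = "sierpinski_power e S"
  let ?f = "\<lambda>z. e {s \<in> S. z \<in> W s}"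
  let ?cone = "\<lambda>P. e ` {R. P \<subseteq> R \<and> R \<subseteq> S}"
  have "well_filtered ?Y"
    using fin by (intro finite_imp_well_filtered) (simp add: topspace_sierpinski_power[OF e])
  then have "\<exists>!y. y \<in> topspace ?Y \<and> ?Y closure_of (?f ` A) = ?Y closure_of {y}"
    using WD[unfolded WD_set_def, THEN conjunct2, rule_format, of ?Y ?f]
      t0_space_sierpinski_power[OF e] continuous_map_into_sierpinski_power[OF e fin W]
    by simp
  then obtain y where y: "y \<in> topspace ?Y" "?Y closure_of (?f ` A) = ?Y closure_of {y}"
    by (elim ex1E conjE)
  obtain P where P: "y = e P" "P \<subseteq> S"
    using y(1) unfolding topspace_sierpinski_power[OF e] by blast
  have mem: "e R \<in> ?cone P' \<longleftrightarrow> P' \<subseteq> R \<and> R \<subseteq> S" for R P'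
    using e by (auto simp: inj_image_mem_iff)
  have same_opens: "?f ` A \<inter> U \<noteq> {} \<longleftrightarrow> y \<in> U" if U: "openin ?Y U" for U
    using openin_Int_closure_of_eq_empty[OF U, of "?f ` A"]
      openin_Int_closure_of_eq_empty[OF U, of "{y}"] y(2) by auto
  have "s \<in> P" if s: "s \<in> S" for s
  proof -
    obtain a where "a \<in> A" "a \<in> W s"
      using meets[OF s] by blast
    then have "?f ` A \<inter> ?cone {s} \<noteq> {}"
      using s by blast
    then have "y \<in> ?cone {s}"
      using same_opens[OF openin_sierpinski_power_cone[OF e]] by blast
    then show ?thesis
      unfolding P(1) mem by blast
  qed
  \<comment> \<open>So \<open>y\<close> is the top point, and its singleton is the open cone over \<open>S\<close>.\<close>
  then have "y \<in> ?cone S"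
    unfolding P(1) mem using P(2) by blast
  then have "?f ` A \<inter> ?cone S \<noteq> {}"
    using same_opens[OF openin_sierpinski_power_cone[OF e]] by blast
  then obtain a where a: "a \<in> A" "?f a \<in> ?cone S"
    by blast
  then show ?thesis
    unfolding mem by blast
qed

text \<open>
  Two closed sets that cover \<open>A\<close>, neither of which contains \<open>A\<close>, are witnessed by two distinct points
  of \<open>A\<close>. Indexing their complements by these points keeps the index set inside the type of \<open>X\<close>.
\<close>

lemma WD_set_imp_irreducible_in:
  fixes X :: "'a topology"
  assumes e: "inj (e :: 'a set \<Rightarrow> 'b)" and WD: "WD_set TYPE('b) X A"
  shows "irreducible_in X A"
  unfolding irreducible_in_def
proof (intro conjI allI impI, goal_cases)
  case 1
  show ?case
    using WD unfolding WD_set_def by blast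
next
  case 2
  show ?case
    using WD_set_meets_finite_Inter[OF e WD, of "{}"] by auto
next
  case (3 B C)
  then have B: "closedin X B" and C: "closedin X C" and cover: "A \<subseteq> B \<union> C"
    by auto
  have top: "A \<subseteq> topspace X"
    using WD unfolding WD_set_def by blast
  show ?case
  proof (rule ccontr)
    assume "\<not> (A \<subseteq> B \<or> A \<subseteq> C)"
    then obtain x y where x: "x \<in> A" "x \<notin> B" and y: "y \<in> A" "y \<notin> C"
      by blast
    have "x \<noteq> y"
      using x y cover by blast
    let ?W = "\<lambda>s. topspace X - (if s = x then B else C)"
    have "\<exists>a\<in>A. \<forall>s\<in>{x, y}. a \<in> ?W s"
    proof (rule WD_set_meets_finite_Inter[OF e WD])
      show "openin X (?W s)" for s
        using B C by auto
      show "A \<inter> ?W s \<noteq> {}" if "s \<in> {x, y}" for s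
        using that x y top \<open>x \<noteq> y\<close> by auto
    qed simp
    then show False
      using cover \<open>x \<noteq> y\<close> by auto
  qed
qed

section \<open>Irreducible sets in second countable spaces\<close>

lemma irreducible_in_meets_Int:
  assumes "irreducible_in X A" "openin X U" "openin X V" "A \<inter> U \<noteq> {}" "A \<inter> V \<noteq> {}"
  shows "A \<inter> (U \<inter> V) \<noteq> {}"
proof
  assume "A \<inter> (U \<inter> V) = {}"
  moreover have "A \<subseteq> topspace X"
    using assms(1) unfolding irreducible_in_def by blast
  ultimately have "A \<subseteq> (topspace X - U) \<union> (topspace X - V)"
    by blast
  then have "A \<subseteq> topspace X - U \<or> A \<subseteq> topspace X - V"
    using assms(1-3) unfolding irreducible_in_def by blast
  then show False
    using assms(4,5) by blast
qed

text \<open>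
  Irreducibility makes the finite intersections of basic open sets that meet \<open>A\<close> meet \<open>A\<close> again;
  countability lets a single sequence descend through all of them.
\<close>

lemma irreducible_in_second_countable_sequence:
  assumes sc: "second_countable X" and irr: "irreducible_in X A"
  obtains x :: "nat \<Rightarrow> 'a" where "range x \<subseteq> A"
    and "\<And>U. openin X U \<Longrightarrow> A \<inter> U \<noteq> {} \<Longrightarrow> \<exists>n. \<forall>k\<ge>n. x k \<in> U"
proof -
  obtain \<B> where \<B>: "countable \<B>" "\<And>V. V \<in> \<B> \<Longrightarrow> openin X V"
    and base: "\<And>U a. openin X U \<Longrightarrow> a \<in> U \<Longrightarrow> \<exists>V\<in>\<B>. a \<in> V \<and> V \<subseteq> U"
    using sc unfolding second_countable_def by metis
  let ?M = "{V \<in> \<B>. A \<inter> V \<noteq> {}}"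
  have A: "A \<subseteq> topspace X" "A \<noteq> {}"
    using irr unfolding irreducible_in_def by auto
  then obtain a where "a \<in> A" "a \<in> topspace X"
    by blast
  moreover from this obtain V where "V \<in> \<B>" "a \<in> V"
    using base[OF openin_topspace] by metis
  ultimately have "?M \<noteq> {}"
    by blast
  moreover have "countable ?M"
    using \<B>(1) by simp
  ultimately obtain B :: "nat \<Rightarrow> 'a set" where B: "range B = ?M"
    by (metis range_from_nat_into)
  then have B_open: "openin X (B i)" and B_meets: "A \<inter> B i \<noteq> {}" for i
    using \<B>(2) by auto
  have "openin X (\<Inter>i\<le>n. B i) \<and> A \<inter> (\<Inter>i\<le>n. B i) \<noteq> {}" for n
  proof (induction n)
    case 0
    show ?case
      using B_open[of 0] B_meets[of 0] by simp
  next
    case (Suc n)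
    have "(\<Inter>i\<le>Suc n. B i) = B (Suc n) \<inter> (\<Inter>i\<le>n. B i)"
      by (simp add: atMost_Suc)
    then show ?case
      using Suc B_open[of "Suc n"] B_meets[of "Suc n"] irreducible_in_meets_Int[OF irr]
      by (metis openin_Int)
  qed
  then have "\<exists>z. z \<in> A \<and> (\<forall>i\<le>n. z \<in> B i)" for n
    by blast
  then obtain x where x: "\<And>n. x n \<in> A" "\<And>n i. i \<le> n \<Longrightarrow> x n \<in> B i"
    by metis
  have "\<exists>n. \<forall>k\<ge>n. x k \<in> U" if U: "openin X U" "A \<inter> U \<noteq> {}" for U
  proof -
    obtain V where V: "V \<in> ?M" "V \<subseteq> U"
      using base[OF U(1)] U(2) by blast
    then obtain n where "V = B n"
      using B by blast
    then show ?thesis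
      using x(2) V(2) by blast
  qed
  then show ?thesis
    using that x(1) by blast
qed

text \<open>
  The sequence converges to each of its own terms, so the member of a cover around the first term of
  the tail already contains almost all of it.
\<close>

lemma compactin_tail:
  assumes A: "A \<subseteq> topspace X" "range x \<subseteq> A"
    and ev: "\<And>U. openin X U \<Longrightarrow> A \<inter> U \<noteq> {} \<Longrightarrow> \<exists>n. \<forall>k\<ge>n. x k \<in> U"
  shows "compactin X (x ` {n::nat..})"
  unfolding compactin_def
proof (intro conjI allI impI)
  show "x ` {n..} \<subseteq> topspace X"
    using A by blast
  fix \<U>
  assume "Ball \<U> (openin X) \<and> x ` {n..} \<subseteq> \<Union>\<U>"
  then have op: "\<forall>U\<in>\<U>. openin X U" and cover: "x ` {n..} \<subseteq> \<Union>\<U>"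
    by auto
  have "\<forall>k\<in>{n..}. \<exists>U\<in>\<U>. x k \<in> U"
    using cover by blast
  then obtain u where u: "\<And>k. n \<le> k \<Longrightarrow> u k \<in> \<U> \<and> x k \<in> u k"
    by (metis atLeast_iff)
  then have "openin X (u n)" "A \<inter> u n \<noteq> {}"
    using op A(2) by blast+
  then obtain m where m: "\<forall>k\<ge>m. x k \<in> u n"
    using ev by blast
  let ?F = "u ` {n..max n m}"
  have "x k \<in> \<Union>?F" if "n \<le> k" for k
  proof (cases "k \<le> m")
    case True
    then show ?thesis
      using u[OF that] that by auto
  next
    case False
    then have "x k \<in> u n"
      using m by simp
    then show ?thesis
      by auto
  qed
  then have "finite ?F \<and> ?F \<subseteq> \<U> \<and> x ` {n..} \<subseteq> \<Union>?F"
    using u by auto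
  then show "\<exists>\<F>. finite \<F> \<and> \<F> \<subseteq> \<U> \<and> x ` {n..} \<subseteq> \<Union>\<F>"
    by blast
qed

definition saturation :: "'a topology \<Rightarrow> 'a set \<Rightarrow> 'a set" where
  "saturation Y S = topspace Y \<inter> \<Inter>{V. openin Y V \<and> S \<subseteq> V}"

lemma saturated_in_saturation: "saturated_in Y (saturation Y S)"
  unfolding saturated_in_def saturation_def
  by (rule exI[of _ "{V. openin Y V \<and> S \<subseteq> V}"]) simp

lemma saturation_mono: "S \<subseteq> T \<Longrightarrow> saturation Y S \<subseteq> saturation Y T"
  unfolding saturation_def by blast

lemma saturation_superset: "S \<subseteq> topspace Y \<Longrightarrow> S \<subseteq> saturation Y S"
  unfolding saturation_def by blast

lemma saturation_least: "openin Y V \<Longrightarrow> S \<subseteq> V \<Longrightarrow> saturation Y S \<subseteq> V"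
  unfolding saturation_def by blast

text \<open>A set and its saturation have the same open covers.\<close>

lemma compactin_saturation:
  assumes S: "compactin Y S"
  shows "compactin Y (saturation Y S)"
  unfolding compactin_def
proof (intro conjI allI impI)
  show "saturation Y S \<subseteq> topspace Y"
    unfolding saturation_def by blast
  fix \<U>
  assume "Ball \<U> (openin Y) \<and> saturation Y S \<subseteq> \<Union>\<U>"
  then have op: "\<forall>U\<in>\<U>. openin Y U" and cover: "saturation Y S \<subseteq> \<Union>\<U>"
    by auto
  have "S \<subseteq> \<Union>\<U>"
    using cover saturation_superset[OF compactin_subset_topspace[OF S]] by blast
  then obtain \<F> where \<F>: "finite \<F>" "\<F> \<subseteq> \<U>" "S \<subseteq> \<Union>\<F>"
    using S op unfolding compactin_def by meson
  then have "saturation Y S \<subseteq> \<Union>\<F>"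
    using op by (intro saturation_least openin_Union) auto
  then show "\<exists>\<F>. finite \<F> \<and> \<F> \<subseteq> \<U> \<and> saturation Y S \<subseteq> \<Union>\<F>"
    using \<F> by blast
qed

text \<open>
  The point comes from well-filteredness, applied to the saturations of the images of the tails and
  to the complement of the closure of \<open>f ` A\<close>.
\<close>

lemma irreducible_image_generic_point:
  assumes sc: "second_countable X" and irr: "irreducible_in X A"
    and wf: "well_filtered Y" and f: "continuous_map X Y f"
  obtains y where "y \<in> topspace Y" "Y closure_of (f ` A) = Y closure_of {y}"
proof -
  obtain x :: "nat \<Rightarrow> 'a" where x: "range x \<subseteq> A"
    and ev: "\<And>U. openin X U \<Longrightarrow> A \<inter> U \<noteq> {} \<Longrightarrow> \<exists>n. \<forall>k\<ge>n. x k \<in> U"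
    using irreducible_in_second_countable_sequence[OF sc irr] by blast
  have A: "A \<subseteq> topspace X"
    using irr unfolding irreducible_in_def by blast
  then have fA: "f ` A \<subseteq> topspace Y"
    using continuous_map_image_subset_topspace[OF f] by blast
  define K where "K n = saturation Y (f ` x ` {n..})" for n
  have K: "compactin Y (K n)" "saturated_in Y (K n)" for n
    unfolding K_def
    using image_compactin[OF compactin_tail[OF A x ev] f]
    by (auto intro: compactin_saturation saturated_in_saturation)
  have anti: "K n \<subseteq> K m" if "m \<le> n" for m n
    unfolding K_def using that by (intro saturation_mono image_mono) auto
  have "filtered_family (range K)"
    unfolding filtered_family_def using anti by (auto intro: max.cobounded1 max.cobounded2)
  moreover have fx: "f (x n) \<in> K n" "f (x n) \<in> Y closure_of (f ` A)" for n
  proof -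
    have "f ` x ` {n..} \<subseteq> f ` A"
      using x by blast
    then have "f ` x ` {n..} \<subseteq> K n"
      unfolding K_def using fA by (intro saturation_superset) blast
    then show "f (x n) \<in> K n"
      by auto
    show "f (x n) \<in> Y closure_of (f ` A)"
      using closure_of_subset[OF fA] x by blast
  qed
  then have "\<not> (\<exists>L\<in>range K. L \<subseteq> topspace Y - Y closure_of (f ` A))"
    by blast
  moreover have "openin Y (topspace Y - Y closure_of (f ` A))"
    by (simp add: openin_diff)
  moreover have "\<forall>L\<in>range K. compactin Y L \<and> saturated_in Y L"
    using K by simp
  ultimately have "\<not> \<Inter>(range K) \<subseteq> topspace Y - Y closure_of (f ` A)"
    using wf[unfolded well_filtered_def, rule_format,
        of "range K" "topspace Y - Y closure_of (f ` A)"] by metis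
  then obtain y where y: "\<And>n. y \<in> K n" and "y \<notin> topspace Y - Y closure_of (f ` A)"
    by blast
  moreover have yY: "y \<in> topspace Y"
    using y[of 0] unfolding K_def saturation_def by blast
  ultimately have ycl: "y \<in> Y closure_of (f ` A)"
    by blast
  have "z \<in> Y closure_of {y}" if z: "z \<in> f ` A" for z
    unfolding in_closure_of
  proof (intro conjI allI impI)
    show "z \<in> topspace Y"
      using z fA by blast
    fix V
    assume V: "z \<in> V \<and> openin Y V"
    let ?U = "{a \<in> topspace X. f a \<in> V}"
    have "openin X ?U"
      using V f by (simp add: openin_continuous_map_preimage)
    moreover have "A \<inter> ?U \<noteq> {}"
      using z V A by blast
    ultimately obtain n where "\<forall>k\<ge>n. x k \<in> ?U"
      using ev by blast
    then have "f ` x ` {n..} \<subseteq> V"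
      by auto
    then have "K n \<subseteq> V"
      unfolding K_def using V by (intro saturation_least) auto
    then show "\<exists>w. w \<in> {y} \<and> w \<in> V"
      using y by blast
  qed
  then have "Y closure_of (f ` A) \<subseteq> Y closure_of {y}"
    by (intro closure_of_minimal) auto
  moreover have "Y closure_of {y} \<subseteq> Y closure_of (f ` A)"
    using ycl by (intro closure_of_minimal) auto
  ultimately show ?thesis
    using that yY by blast
qed

lemma irreducible_in_imp_WD_set:
  assumes sc: "second_countable X" and irr: "irreducible_in X A"
  shows "WD_set TYPE('b) X A"
  unfolding WD_set_def
proof (intro conjI allI impI)
  show "A \<subseteq> topspace X"
    using irr unfolding irreducible_in_def by blast
  fix Y :: "'b topology" and f
  assume "t0_space Y \<and> well_filtered Y \<and> continuous_map X Y f"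
  then have t0: "t0_space Y" and wf: "well_filtered Y" and f: "continuous_map X Y f"
    by auto
  obtain y where y: "y \<in> topspace Y" "Y closure_of (f ` A) = Y closure_of {y}"
    by (rule irreducible_image_generic_point[OF sc irr wf f])
  have "z = y" if z: "z \<in> topspace Y" "Y closure_of (f ` A) = Y closure_of {z}" for z
  proof (rule ccontr)
    assume "z \<noteq> y"
    then obtain U where U: "openin Y U" "z \<notin> U \<longleftrightarrow> y \<in> U"
      using t0 z(1) y(1) unfolding t0_space_def by blast
    have "U \<inter> {z} = {} \<longleftrightarrow> U \<inter> {y} = {}"
      using openin_Int_closure_of_eq_empty[OF U(1)] z(2) y(2) by metis
    then show False
      using U(2) by blast
  qed
  then show "\<exists>!y. y \<in> topspace Y \<and> Y closure_of (f ` A) = Y closure_of {y}"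
    using y by blast
qed

section \<open>The two completions coincide\<close>

theorem proposition3p10:
  fixes X :: "'a topology"
  assumes "second_countable X" and "t0_space X"
    and universe: "\<exists>e :: 'a set \<Rightarrow> 'b. inj e"
  shows "WD TYPE('b) X = IRR X \<and> well_filterification TYPE('b) X = sobrification X"
proof -
  obtain e :: "'a set \<Rightarrow> 'b" where "inj e"
    using universe by blast
  then have "WD_set TYPE('b) X A \<longleftrightarrow> irreducible_in X A" for A
    using WD_set_imp_irreducible_in irreducible_in_imp_WD_set[OF assms(1)] by metis
  then have "WD TYPE('b) X = IRR X"
    unfolding WD_def IRR_def by simp
  then show ?thesis
    unfolding well_filterification_def sobrification_def by simp
qed

end
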